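(* For all integers $n\ge k\ge 1$, $${n \brace k}_{Y,\lambda}=\frac{1}{k}\sum_{j=k-1}^{n-1}\binom{n}{j}{j\brace k-1}_{Y,\lambda}E[(Y)_{n-j,\lambda}].$$ In particular, for every integer $k\ge1$, ${k \brace k}_{Y,\lambda}=\big(E[Y]\big)^{k}$.
   Context: $\lambda$ is a fixed nonzero real number. For real $x$: $(x)_{0,\lambda}=1$, $(x)_{n,\lambda}=x(x-\lambda)\cdots(x-(n-1)\lambda)$ for $n\ge1$. The degenerate exponential is $e_{\lambda}^{x}(t)=(1+\lambda t)^{x/\lambda}=\sum_{n\ge0}(x)_{n,\lambda}\frac{t^n}{n!}$. $Y$ is a real random variable whose degenerate moment generating functions exist near the origin: for every nonzero real $\lambda$ there is $r=r(\lambda)>0$ with $E[e_{\lambda}^{Y}(t)]=\sum_{n\ge0}E[(Y)_{n,\lambda}]\frac{t^n}{n!}$ for $|t|<r$. The probabilistic degenerate Stirling numbers of the second kind associated with $Y$ are defined by the power series expansion at $t=0$: $\frac{1}{k!}\big(E[e_{\lambda}^{Y}(t)]-1\big)^k=\sum_{n\ge k}{n\brace k}_{Y,\lambda}\frac{t^n}{n!}$, $k\ge0$. *)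

theory Defs
  imports "HOL-Probability.Probability"
begin

definition degenerate_falling :: "real \<Rightarrow> nat \<Rightarrow> real \<Rightarrow> real" where
  "degenerate_falling lam n x = (\<Prod>i<n. x - real i * lam)"

text \<open>Meaningful for \<open>lam \<noteq> 0\<close> and \<open>1 + lam * t > 0\<close>; it is only used for \<open>t\<close> near \<open>0\<close>.\<close>

definition degenerate_exp :: "real \<Rightarrow> real \<Rightarrow> real \<Rightarrow> real" where
  "degenerate_exp lam x t = (1 + lam * t) powr (x / lam)"

lemma degenerate_exp_sums:
  assumes "lam \<noteq> 0" "\<bar>lam * t\<bar> < 1"
  shows "(\<lambda>n. degenerate_falling lam n x * t ^ n / fact n) sums degenerate_exp lam x t"
proof -
  have "degenerate_falling lam n x * t ^ n / fact n = ((x / lam) gchoose n) * (lam * t) ^ n" for n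
  proof -
    have "degenerate_falling lam n x = (\<Prod>i<n. lam * (x / lam - real i))"
      unfolding degenerate_falling_def using assms(1) by (intro prod.cong) (auto simp: field_simps)
    also have "\<dots> = lam ^ n * (\<Prod>i<n. x / lam - real i)"
      by (simp add: prod.distrib)
    finally show ?thesis
      by (simp add: gbinomial_prod_rev atLeast0LessThan power_mult_distrib field_simps)
  qed
  with gen_binomial_real[OF assms(2), of "x / lam"] show ?thesis
    by (simp add: degenerate_exp_def)
qed

definition degenerate_mgf :: "'a measure \<Rightarrow> ('a \<Rightarrow> real) \<Rightarrow> real \<Rightarrow> real \<Rightarrow> real" where
  "degenerate_mgf M Y lam t = prob_space.expectation M (\<lambda>w. degenerate_exp lam (Y w) t)"

text \<open>The expectations involved are required to exist: the Bochner integral of a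
  non-integrable function is \<open>0\<close> by convention.\<close>

definition degenerate_mgf_exists :: "'a measure \<Rightarrow> ('a \<Rightarrow> real) \<Rightarrow> real \<Rightarrow> bool" where
  "degenerate_mgf_exists M Y lam \<longleftrightarrow>
     (\<forall>n. integrable M (\<lambda>w. degenerate_falling lam n (Y w))) \<and>
     (\<exists>r>0. \<forall>t. \<bar>t\<bar> < r \<longrightarrow>
        integrable M (\<lambda>w. degenerate_exp lam (Y w) t) \<and>
        (\<lambda>n. prob_space.expectation M (\<lambda>w. degenerate_falling lam n (Y w)) * t ^ n / fact n)
          sums degenerate_mgf M Y lam t)"

text \<open>The coefficients of \<open>t ^ n / fact n\<close> in the expansion at \<open>t = 0\<close> of
  \<open>(degenerate_mgf M Y lam t - 1) ^ k / fact k\<close>. The series starts at \<open>n = k\<close>; the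
  coefficients with \<open>n < k\<close> are set to \<open>0\<close>.\<close>

definition prob_degenerate_stirling ::
  "'a measure \<Rightarrow> ('a \<Rightarrow> real) \<Rightarrow> real \<Rightarrow> nat \<Rightarrow> nat \<Rightarrow> real" where
  "prob_degenerate_stirling M Y lam n k =
     (THE S. (\<forall>m<k. S m = 0) \<and>
        (\<exists>r>0. \<forall>t. \<bar>t\<bar> < r \<longrightarrow>
           (\<lambda>m. S m * t ^ m / fact m) sums ((degenerate_mgf M Y lam t - 1) ^ k / fact k))) n"

end

theory Submission
  imports Defs
begin

text \<open>With \<open>F t = E[e_lam^Y(t)] - 1\<close>, the identity
  \<open>F ^ k / k! = (1 / k) * (F ^ (k - 1) / (k - 1)!) * F\<close> is compared coefficientwise. Since
  \<open>F 0 = 0\<close>, the coefficient of \<open>t ^ k\<close> in \<open>F ^ k\<close> is the \<open>k\<close>-th power of the linear coefficient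
  \<open>E[Y]\<close> of \<open>F\<close>.\<close>

text \<open>Strong induction: once the coefficients below \<open>n\<close> vanish, dividing the
  series by \<open>t ^ n\<close> leaves one whose limit at 0 is \<open>d n\<close>.\<close>

lemma powser_eq_0D:
  fixes d :: "nat \<Rightarrow> 'a::{real_normed_field,banach}"
  assumes "0 < r" and sums: "\<And>t. norm t < r \<Longrightarrow> (\<lambda>n. d n * t ^ n) sums 0"
  shows "d n = 0"
proof (induction n rule: less_induct)
  case (less n)
  have "(\<lambda>m. d (m + n) * t ^ m) sums 0" if t: "t \<noteq> 0" "norm t < r" for t
  proof -
    have "(\<lambda>m. d (m + n) * t ^ (m + n)) sums (0 - (\<Sum>i<n. d i * t ^ i))"
      by (rule sums_split_initial_segment[OF sums[OF t(2)]])
    then have "(\<lambda>m. (d (m + n) * t ^ m) * t ^ n) sums (0 * t ^ n)"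
      using less.IH by (simp add: power_add mult.assoc)
    then show ?thesis
      using t(1) by (subst (asm) sums_mult2_iff) simp_all
  qed
  \<comment> \<open>Cancelling \<open>t ^ n\<close> gives the sum 0 on the punctured disc only, so
    \<open>d n\<close> is reached as a limit at 0 instead of by putting
    \<open>t = 0\<close>.\<close>
  then have "((\<lambda>_. 0 :: 'a) \<longlongrightarrow> d (0 + n)) (at (0 :: 'a))"
    using powser_limit_0_strong[OF \<open>0 < r\<close>, of "\<lambda>m. d (m + n)" "\<lambda>_. 0"] by blast
  then show ?case
    by (simp add: tendsto_const_iff)
qed

lemma powser_coeff_unique:
  fixes a b :: "nat \<Rightarrow> 'a::{real_normed_field,banach}"
  assumes "0 < r" "0 < s"
    and a: "\<And>t. norm t < r \<Longrightarrow> (\<lambda>n. a n * t ^ n) sums f t"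
    and b: "\<And>t. norm t < s \<Longrightarrow> (\<lambda>n. b n * t ^ n) sums f t"
  shows "a = b"
proof
  fix n
  have "(\<lambda>n. (a n - b n) * t ^ n) sums 0" if "norm t < min r s" for t
    using sums_diff[OF a b, of t t] that by (simp add: left_diff_distrib)
  then show "a n = b n"
    using powser_eq_0D[of "min r s" "\<lambda>n. a n - b n" n] assms(1,2) by simp
qed

text \<open>Convergence for all \<open>t\<close> of norm below \<open>r\<close> bounds the
  convergence radius of \<open>F\<close> from below by \<open>r\<close>, and inside that radius
  evaluation commutes with powers.\<close>

lemma fps_power_sums:
  fixes F :: "'a::{banach, real_normed_field} fps"
  assumes sums: "\<And>t. norm t < r \<Longrightarrow> (\<lambda>n. fps_nth F n * t ^ n) sums f t"
    and t: "norm t < r"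
  shows "(\<lambda>n. fps_nth (F ^ k) n * t ^ n) sums f t ^ k"
proof -
  have "ereal r \<le> fps_conv_radius F"
    unfolding fps_conv_radius_def
    by (rule conv_radius_geI_ex') (use sums in \<open>force simp: sums_iff\<close>)
  with t have radius: "ereal (norm t) < fps_conv_radius F"
    by (meson ereal_less(2) less_le_trans less_ereal.simps(1))
  then have "(\<lambda>n. fps_nth (F ^ k) n * t ^ n) sums eval_fps (F ^ k) t"
    by (intro sums_eval_fps less_le_trans[OF _ fps_conv_radius_power])
  moreover have "eval_fps F t = f t"
    using sums[OF t] by (simp add: eval_fps_def sums_iff)
  ultimately show ?thesis
    using radius by (simp add: eval_fps_power)
qed

text \<open>The formal counterpart of E[e_lam^Y(t)], with the factorials absorbed into the
  coefficients so that products are plain Cauchy products.\<close>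

definition degenerate_mgf_fps :: "'a measure \<Rightarrow> ('a \<Rightarrow> real) \<Rightarrow> real \<Rightarrow> real fps" where
  "degenerate_mgf_fps M Y lam =
     Abs_fps (\<lambda>n. prob_space.expectation M (\<lambda>w. degenerate_falling lam n (Y w)) / fact n)"

lemma degenerate_mgf_fps_nth_0:
  assumes "prob_space M"
  shows "fps_nth (degenerate_mgf_fps M Y lam) 0 = 1"
  using assms by (simp add: degenerate_mgf_fps_def degenerate_falling_def prob_space.prob_space)

lemma degenerate_mgf_fps_nth_1:
  "fps_nth (degenerate_mgf_fps M Y lam) 1 = prob_space.expectation M Y"
  by (simp add: degenerate_mgf_fps_def degenerate_falling_def)

text \<open>The bridge from the analytic definition to formal power series; what follows it is
  algebra of coefficients.\<close>

lemma prob_degenerate_stirling_eq_fps_nth: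
  assumes M: "prob_space M" and mgf: "degenerate_mgf_exists M Y lam"
  shows "prob_degenerate_stirling M Y lam n k =
           fact n / fact k * fps_nth ((degenerate_mgf_fps M Y lam - 1) ^ k) n"
proof -
  define F where "F = degenerate_mgf_fps M Y lam - 1"
  define T where "T = (\<lambda>n. fact n / fact k * fps_nth (F ^ k) n)"
  define f where "f = (\<lambda>t. (degenerate_mgf M Y lam t - 1) ^ k / fact k)"
  obtain r where r: "0 < r" and sums_mgf:
    "\<And>t. \<bar>t\<bar> < r \<Longrightarrow> (\<lambda>n. prob_space.expectation M (\<lambda>w. degenerate_falling lam n (Y w)) * t ^ n / fact n)
       sums degenerate_mgf M Y lam t"
    using mgf unfolding degenerate_mgf_exists_def by blast
  have "(\<lambda>n. fps_nth F n * t ^ n) sums (degenerate_mgf M Y lam t - 1)" if "\<bar>t\<bar> < r" for t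
  proof -
    have "(\<lambda>n. fps_nth (1 :: real fps) n * t ^ n) sums 1"
      using sums_single[of 0 "\<lambda>_. 1 :: real"] by (rule sums_cong[THEN iffD1, rotated]) auto
    from sums_diff[OF sums_mgf[OF that] this] show ?thesis
      by (simp add: F_def degenerate_mgf_fps_def left_diff_distrib)
  qed
  from fps_power_sums[of r F, simplified, OF this]
  have sums_power: "(\<lambda>n. fps_nth (F ^ k) n * t ^ n) sums (degenerate_mgf M Y lam t - 1) ^ k"
    if "\<bar>t\<bar> < r" for t
    using that by blast
  have T_sums: "(\<lambda>n. T n * t ^ n / fact n) sums f t" if "\<bar>t\<bar> < r" for t
    using sums_divide[OF sums_power[OF that], of "fact k"] by (simp add: T_def f_def)
  \<comment> \<open>Without a constant term, \<open>F ^ k\<close> starts at degree \<open>k\<close>,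
    as the definition demands of \<open>S\<close>.\<close>
  have "fps_nth F 0 = 0"
    using degenerate_mgf_fps_nth_0[OF M] by (simp add: F_def)
  then have T_0: "\<forall>m<k. T m = 0"
    using startsby_zero_power_prefix by (auto simp: T_def)
  have "(THE S. (\<forall>m<k. S m = 0) \<and>
          (\<exists>r>0. \<forall>t. \<bar>t\<bar> < r \<longrightarrow> (\<lambda>m. S m * t ^ m / fact m) sums f t)) = T"
  proof (rule the_equality)
    show "(\<forall>m<k. T m = 0) \<and> (\<exists>r>0. \<forall>t. \<bar>t\<bar> < r \<longrightarrow> (\<lambda>m. T m * t ^ m / fact m) sums f t)"
      using r T_0 T_sums by blast
  next
    fix S :: "nat \<Rightarrow> real"
    assume "(\<forall>m<k. S m = 0) \<and> (\<exists>r>0. \<forall>t. \<bar>t\<bar> < r \<longrightarrow> (\<lambda>m. S m * t ^ m / fact m) sums f t)"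
    then obtain s where "0 < s" and "\<And>t. \<bar>t\<bar> < s \<Longrightarrow> (\<lambda>m. S m * t ^ m / fact m) sums f t"
      by blast
    \<comment> \<open>Both are the ordinary Taylor coefficients of \<open>f\<close> at 0; the radius
      \<open>s\<close> comes with \<open>S\<close> and may differ from \<open>r\<close>.\<close>
    then have "(\<lambda>m. S m / fact m) = (\<lambda>m. T m / fact m)"
      using r T_sums by (intro powser_coeff_unique[of s r _ f]) simp_all
    then show "S = T"
      by (auto simp: fun_eq_iff)
  qed
  then show ?thesis
    by (simp add: prob_degenerate_stirling_def f_def T_def F_def)
qed

lemma prob_degenerate_stirling_rec:
  assumes M: "prob_space M" and mgf: "degenerate_mgf_exists M Y lam"
    and k: "1 \<le> k" "k \<le> n"
  shows "prob_degenerate_stirling M Y lam n k =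
           1 / real k * (\<Sum>j = k - 1..n - 1. real (n choose j)
             * prob_degenerate_stirling M Y lam j (k - 1)
             * prob_space.expectation M (\<lambda>w. degenerate_falling lam (n - j) (Y w)))"
proof -
  define F where "F = degenerate_mgf_fps M Y lam - 1"
  define E where "E = (\<lambda>n. prob_space.expectation M (\<lambda>w. degenerate_falling lam n (Y w)))"
  note stirling = prob_degenerate_stirling_eq_fps_nth[OF M mgf, folded F_def]
  obtain l where l: "k = Suc l"
    using k by (cases k) auto
  have F_0: "fps_nth F 0 = 0"
    using degenerate_mgf_fps_nth_0[OF M] by (simp add: F_def)
  have F_nth: "fps_nth F i = E i / fact i" if "i > 0" for i
    using that by (simp add: F_def E_def degenerate_mgf_fps_def)
  have "fps_nth (F ^ k) n = (\<Sum>j=0..n. fps_nth (F ^ l) j * fps_nth F (n - j))"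
    unfolding l power_Suc2 by (rule fps_mult_nth)
  \<comment> \<open>The terms with \<open>j < l\<close> vanish because \<open>F ^ l\<close> starts
    at degree \<open>l\<close>; the term \<open>j = n\<close> contains the constant term of
    \<open>F\<close>, which is 0.\<close>
  also have "\<dots> = (\<Sum>j=l..n - 1. fps_nth (F ^ l) j * fps_nth F (n - j))"
  proof (rule sum.mono_neutral_right)
    show "\<forall>j\<in>{0..n} - {l..n - 1}. fps_nth (F ^ l) j * fps_nth F (n - j) = 0"
    proof
      fix j assume "j \<in> {0..n} - {l..n - 1}"
      then have "j < l \<or> j = n"
        by auto
      then show "fps_nth (F ^ l) j * fps_nth F (n - j) = 0"
        using startsby_zero_power_prefix[OF F_0] F_0 by auto
    qed
  qed auto
  finally have "prob_degenerate_stirling M Y lam n k =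
      fact n / fact k * (\<Sum>j=l..n - 1. fps_nth (F ^ l) j * fps_nth F (n - j))"
    by (simp add: stirling)
  also have "\<dots> = 1 / real k * (\<Sum>j=l..n - 1. real (n choose j)
      * prob_degenerate_stirling M Y lam j l * E (n - j))"
    unfolding sum_distrib_left
  proof (rule sum.cong)
    fix j assume "j \<in> {l..n - 1}"
    \<comment> \<open>So \<open>n - j > 0\<close>, and the coefficient of \<open>F\<close> there is
      a moment, unaffected by subtracting 1. The factorials then combine through
      \<open>fact k = k * fact l\<close> into \<open>1 / k\<close> and the binomial
      coefficient.\<close>
    then have "j < n"
      using k by auto
    then show "fact n / fact k * (fps_nth (F ^ l) j * fps_nth F (n - j)) =
        1 / real k * (real (n choose j) * prob_degenerate_stirling M Y lam j l * E (n - j))"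
      by (simp add: stirling F_nth binomial_fact l field_simps)
  qed simp
  finally show ?thesis
    by (simp add: l E_def)
qed

text \<open>At \<open>n = k\<close> the factor \<open>fact n / fact k\<close> is 1. The parameter
  \<open>lam\<close> drops out because the degenerate falling factorial of degree 1 is the
  identity.\<close>

lemma prob_degenerate_stirling_diag:
  assumes M: "prob_space M" and mgf: "degenerate_mgf_exists M Y lam"
  shows "prob_degenerate_stirling M Y lam k k = prob_space.expectation M Y ^ k"
  using degenerate_mgf_fps_nth_1[of M Y lam]
  by (simp add: prob_degenerate_stirling_eq_fps_nth[OF M mgf] startsby_zero_power_nth_same
      degenerate_mgf_fps_nth_0[OF M])

theorem theorem2p9:
  fixes M :: "'a measure" and Y :: "'a \<Rightarrow> real" and lam :: real
  assumes "prob_space M"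
    and "Y \<in> borel_measurable M"
    and "\<And>l. l \<noteq> 0 \<Longrightarrow> degenerate_mgf_exists M Y l"
    and "lam \<noteq> 0"
  shows "(\<forall>n k::nat. 1 \<le> k \<and> k \<le> n \<longrightarrow>
            prob_degenerate_stirling M Y lam n k =
              1 / real k * (\<Sum>j = k - 1..n - 1. real (n choose j)
                * prob_degenerate_stirling M Y lam j (k - 1)
                * prob_space.expectation M (\<lambda>w. degenerate_falling lam (n - j) (Y w))))
       \<and> (\<forall>k::nat\<ge>1. prob_degenerate_stirling M Y lam k k = prob_space.expectation M Y ^ k)"
  using prob_degenerate_stirling_rec[OF assms(1) assms(3)[OF assms(4)]]
    prob_degenerate_stirling_diag[OF assms(1) assms(3)[OF assms(4)]]
  by blast

end
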